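(* Let $k\ge 2$ and let $\mathcal{H}=(V,\mathcal{E})$ be a $k$-uniform 2-hypertree on $n=|V|\ge k$ vertices. Then $$|\mathcal{E}|\le \frac{1}{k-1}\binom{n}{k-1}-\frac{1}{(k-1)^3}\binom{n}{k-2}.$$
   Context: A $k$-uniform hypergraph $\mathcal{H}=(V,\mathcal{E})$ consists of a finite vertex set $V$ and a set $\mathcal{E}$ of $k$-element subsets of $V$ (no multiple edges). A $k$-uniform hypergraph is a chain if there is a sequence $v_1,\dots,v_l$ of its vertices in which every vertex appears at least once (possibly more times), $v_1\ne v_l$, and its edge set consists of exactly the $l-k+1$ distinct sets $\{v_i,\dots,v_{i+k-1}\}$, $1\le i\le l-k+1$; it is a semicycle if the same holds with $v_1=v_l$ instead. The length of a chain or semicycle is its number of edges. $\mathcal{H}$ is chain-connected if every pair of distinct vertices is contained in some subhypergraph of $\mathcal{H}$ that is a chain; semicycle-free if no subhypergraph is a semicycle. A hypertree is a chain-connected, semicycle-free $k$-uniform hypergraph. A 2-hypertree is a hypertree in which every subhypergraph that is a chain has length at most $2$. *)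

theory Defs
  imports Complex_Main
begin

text \<open>A hypergraph is given by its vertex set \<open>V\<close> and its edge set \<open>E\<close>.\<close>

definition uniform_hypergraph :: "nat \<Rightarrow> 'a set \<Rightarrow> 'a set set \<Rightarrow> bool" where
  "uniform_hypergraph k V E \<longleftrightarrow> finite V \<and> (\<forall>e\<in>E. e \<subseteq> V \<and> card e = k)"

text \<open>Subhypergraphs are not required to be induced or spanning.\<close>

definition subhypergraph :: "'a set \<Rightarrow> 'a set set \<Rightarrow> 'a set \<Rightarrow> 'a set set \<Rightarrow> bool" where
  "subhypergraph V' E' V E \<longleftrightarrow> V' \<subseteq> V \<and> E' \<subseteq> E \<and> (\<forall>e\<in>E'. e \<subseteq> V')"

text \<open>With 0-based list indices, \<open>window k vs i\<close> is $\{v_{i+1},\dots,v_{i+k}\}$.\<close>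

definition window :: "nat \<Rightarrow> 'a list \<Rightarrow> nat \<Rightarrow> 'a set" where
  "window k vs i = set (take k (drop i vs))"

text \<open>
  The sequence \<open>vs\<close>, of length $l \ge k$, visits every vertex, and its $l - k + 1$ windows are
  pairwise distinct and are exactly the edges. The condition $l \ge k$ says that there is at
  least one edge; otherwise a single vertex without edges would already be a semicycle.
\<close>

definition traces :: "nat \<Rightarrow> 'a list \<Rightarrow> 'a set \<Rightarrow> 'a set set \<Rightarrow> bool" where
  "traces k vs V E \<longleftrightarrow>
     k \<le> length vs \<and> set vs = V \<and> bij_betw (window k vs) {0..<length vs - k + 1} E"

definition chain :: "nat \<Rightarrow> 'a set \<Rightarrow> 'a set set \<Rightarrow> bool" where
  "chain k V E \<longleftrightarrow>
     uniform_hypergraph k V E \<and> (\<exists>vs. traces k vs V E \<and> hd vs \<noteq> last vs)"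

definition semicycle :: "nat \<Rightarrow> 'a set \<Rightarrow> 'a set set \<Rightarrow> bool" where
  "semicycle k V E \<longleftrightarrow>
     uniform_hypergraph k V E \<and> (\<exists>vs. traces k vs V E \<and> hd vs = last vs)"

definition chain_connected :: "nat \<Rightarrow> 'a set \<Rightarrow> 'a set set \<Rightarrow> bool" where
  "chain_connected k V E \<longleftrightarrow>
     (\<forall>u\<in>V. \<forall>v\<in>V. u \<noteq> v \<longrightarrow>
        (\<exists>V' E'. subhypergraph V' E' V E \<and> chain k V' E' \<and> u \<in> V' \<and> v \<in> V'))"

definition semicycle_free :: "nat \<Rightarrow> 'a set \<Rightarrow> 'a set set \<Rightarrow> bool" where
  "semicycle_free k V E \<longleftrightarrow> \<not> (\<exists>V' E'. subhypergraph V' E' V E \<and> semicycle k V' E')"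

definition hypertree :: "nat \<Rightarrow> 'a set \<Rightarrow> 'a set set \<Rightarrow> bool" where
  "hypertree k V E \<longleftrightarrow>
     uniform_hypergraph k V E \<and> chain_connected k V E \<and> semicycle_free k V E"

definition two_hypertree :: "nat \<Rightarrow> 'a set \<Rightarrow> 'a set set \<Rightarrow> bool" where
  "two_hypertree k V E \<longleftrightarrow>
     hypertree k V E \<and>
     (\<forall>V' E'. subhypergraph V' E' V E \<and> chain k V' E' \<longrightarrow> card E' \<le> 2)"

end

theory Submission
  imports Defs
begin

text \<open>
  Two edges meeting in $k-1$ vertices form a chain of length 2, and an edge that meets two others
  in different $(k-1)$-sets would give a chain or semicycle of length 3. Hence every edge \<open>e\<close> has a
  kernel \<open>K e\<close> of size $k-1$ such that each of its other $k-1$ subsets of size $k-1$ lies in no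
  further edge. If \<open>M\<close> is the set of kernels and \<open>U\<close> the set of $(k-1)$-sets lying in no edge, then
  $(k-1)|E| + |M| + |U| \le \binom{n}{k-1}$, and it remains to see that
  $\binom{n}{k-2} \le (k-1)^2(|M| + |U|)$. At most $(k-1)(|M|+|U|)$ of the $(k-2)$-sets lie in
  a member of \<open>M\<close> or \<open>U\<close>. For any other $(k-2)$-set \<open>T\<close>, the edges containing \<open>T\<close> cover all
  vertices, two outside \<open>T\<close> each, and \<open>T\<close> is not in their kernels. Double counting such pairs
  of \<open>T\<close> and edge, together with $|E| \le |M|(n-k+1)$, bounds the number of such \<open>T\<close> by
  $(k-1)(k-2)|M|$.
\<close>

section \<open>Shared subsets of edges and the existence of kernels\<close>

lemma uniform_hypergraphD:
  assumes "uniform_hypergraph k V E" "e \<in> E"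
  shows "e \<subseteq> V" "card e = k" "finite e"
  using assms finite_subset unfolding uniform_hypergraph_def by blast+

lemma insert_eq_if_card_Suc:
  assumes "finite f" "S \<subseteq> f" "card f = Suc (card S)"
  obtains x where "x \<notin> S" "f = insert x S"
proof -
  have "card (f - S) = 1"
    using assms by (simp add: card_Diff_subset finite_subset)
  then obtain x where "f - S = {x}" by (auto simp: card_1_singleton_iff)
  then show thesis using that assms(2) by blast
qed

lemma two_hypertree_shared_subset_unique:
  assumes tree: "two_hypertree (Suc (Suc j)) V E"
    and edges: "e \<in> E" "f \<in> E" "g \<in> E"
    and sub: "K \<subseteq> e" "K \<subseteq> f" "S \<subseteq> e" "S \<subseteq> g"
    and card: "card K = Suc j" "card S = Suc j"
    and neq: "f \<noteq> e" "g \<noteq> e"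
  shows "K = S"
proof (rule ccontr)
  assume "K \<noteq> S"
  have unif: "uniform_hypergraph (Suc (Suc j)) V E"
    using tree by (simp add: two_hypertree_def hypertree_def)
  note D = uniform_hypergraphD[OF unif]
  obtain a where a: "a \<notin> K" "e = insert a K"
    using insert_eq_if_card_Suc[of e K] D edges sub card by auto
  obtain b where b: "b \<notin> S" "e = insert b S"
    using insert_eq_if_card_Suc[of e S] D edges sub card by auto
  obtain x where x: "x \<notin> K" "f = insert x K"
    using insert_eq_if_card_Suc[of f K] D edges sub card by auto
  obtain y where y: "y \<notin> S" "g = insert y S"
    using insert_eq_if_card_Suc[of g S] D edges sub card by auto
  have KS: "K = e - {a}" "S = e - {b}" using a b by auto
  have ab: "a \<in> e" "b \<in> e" using a b by blast+
  have "a \<noteq> b" using KS \<open>K \<noteq> S\<close> by blast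
  note ab = ab this
  have xy: "x \<notin> e" "y \<notin> e" using x y a b neq by (metis insertE)+
  have fe: "finite e" using D edges by blast
  obtain ds where ds: "set ds = e - {a, b}" "distinct ds"
    using finite_distinct_list[of "e - {a, b}"] fe by blast
  have len: "length ds = j"
  proof -
    have "length ds = card (e - {a, b})" using ds distinct_card by metis
    also have "\<dots> = card e - 2" using ab fe by (simp add: card_Diff_subset)
    finally show ?thesis using D edges by simp
  qed
  \<comment> \<open>The common part \<open>ds\<close> of \<open>K\<close> and \<open>S\<close> sits
    in the middle. Dropping \<open>a\<close> from \<open>e\<close> leaves \<open>K\<close> and
    dropping \<open>b\<close> leaves \<open>S\<close>, so the three consecutive windows are
    \<open>f\<close>, \<open>e\<close>, \<open>g\<close>.\<close>
  define vs where "vs = x # b # ds @ [a, y]"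
  define k where "k = Suc (Suc j)"
  have w: "window k vs 0 = f" "window k vs 1 = e" "window k vs 2 = g"
    using ds ab x y KS len by (auto simp: window_def vs_def k_def)
  \<comment> \<open>Even if \<open>x = y\<close>, the vertex \<open>b\<close> lies in
    \<open>f\<close> but not in \<open>g\<close>.\<close>
  have dist: "f \<noteq> e" "g \<noteq> e" "f \<noteq> g"
    using neq x y xy ab KS by auto
  have idx: "{0..<length vs - k + 1} = {0, 1, 2}"
    using len by (auto simp: vs_def k_def)
  have "bij_betw (window k vs) {0, 1, 2} {f, e, g}"
    using w dist unfolding bij_betw_def inj_on_def by force
  then have traces: "traces k vs (set vs) {f, e, g}"
    unfolding traces_def idx using len by (simp add: vs_def k_def)
  have set_vs: "set vs = e \<union> f \<union> g"
    using ds ab x y KS by (auto simp: vs_def)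
  have hyp: "uniform_hypergraph k (set vs) {f, e, g}"
    using D edges by (auto simp: uniform_hypergraph_def set_vs k_def)
  have subhyp: "subhypergraph (set vs) {f, e, g} V E"
    using D(1) edges by (auto simp: subhypergraph_def set_vs)
  show False
  \<comment> \<open>The ends of \<open>vs\<close> are \<open>x\<close> and \<open>y\<close>:
    equality contradicts semicycle-freeness, inequality the length bound for chains.\<close>
  proof (cases "x = y")
    case True
    then have "semicycle k (set vs) {f, e, g}"
      using hyp traces unfolding semicycle_def by (intro conjI exI[of _ vs]) (auto simp: vs_def)
    then show False
      using tree subhyp
      unfolding two_hypertree_def hypertree_def semicycle_free_def k_def by blast
  next
    case False
    then have "chain k (set vs) {f, e, g}"
      using hyp traces unfolding chain_def by (intro conjI exI[of _ vs]) (auto simp: vs_def)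
    then have "card {f, e, g} \<le> 2"
      using tree subhyp unfolding two_hypertree_def k_def by blast
    then show False using dist by auto
  qed
qed

text \<open>If \<open>e\<close> shares a subset of size \<open>Suc j\<close> with another edge, that
  subset is the only such one and serves as kernel. If it shares none, any subset of this size will
  do.\<close>

lemma two_hypertree_kernel:
  assumes tree: "two_hypertree (Suc (Suc j)) V E" and e: "e \<in> E"
  shows "\<exists>K\<subseteq>e. card K = Suc j \<and>
    (\<forall>S f. S \<subseteq> e \<and> card S = Suc j \<and> S \<noteq> K \<and> f \<in> E \<and> S \<subseteq> f \<longrightarrow> f = e)"
proof (cases "\<exists>K f. K \<subseteq> e \<and> card K = Suc j \<and> f \<in> E \<and> f \<noteq> e \<and> K \<subseteq> f")
  case True
  then obtain K f where "K \<subseteq> e" "card K = Suc j" "f \<in> E" "f \<noteq> e" "K \<subseteq> f" by blast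
  with two_hypertree_shared_subset_unique[OF tree e] show ?thesis by metis
next
  case False
  have "uniform_hypergraph (Suc (Suc j)) V E"
    using tree by (simp add: two_hypertree_def hypertree_def)
  then have "Suc j \<le> card e" using uniform_hypergraphD(2) e by fastforce
  then obtain K where "K \<subseteq> e" "card K = Suc j" by (meson obtain_subset_with_card_n)
  with False show ?thesis by metis
qed

lemma Suc_Suc_choose_double: "2 * (Suc (Suc j) choose j) = (j + 2) * (j + 1)"
  using binomial_symmetric[of j "Suc (Suc j)"] choose_two[of "Suc (Suc j)"] by simp

text \<open>The counting uses only these kernel properties. Writing the uniformity as
  \<open>Suc (Suc j)\<close> makes $k-1$ and $k-2$ into \<open>Suc j\<close> and \<open>j\<close>,
  free of truncated subtraction.\<close>

locale kernel_hypergraph =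
  fixes V :: "'a set" and E :: "'a set set" and j :: nat and K :: "'a set \<Rightarrow> 'a set"
  assumes uniform: "uniform_hypergraph (Suc (Suc j)) V E"
    and kernel_subset: "e \<in> E \<Longrightarrow> K e \<subseteq> e"
    and card_kernel: "e \<in> E \<Longrightarrow> card (K e) = Suc j"
    and kernel_unique: "\<lbrakk>e \<in> E; f \<in> E; S \<subseteq> e; S \<subseteq> f; card S = Suc j; S \<noteq> K e\<rbrakk> \<Longrightarrow> f = e"
    and card_V: "Suc (Suc j) \<le> card V"
begin

lemmas edgeD = uniform_hypergraphD[OF uniform]

lemma finite_V: "finite V"
  using uniform by (simp add: uniform_hypergraph_def)

lemma finite_E: "finite E"
  using finite_V edgeD(1) by (meson Sup_le_iff finite_UnionD finite_subset)

lemma finite_kernel: "e \<in> E \<Longrightarrow> finite (K e)"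
  using kernel_subset edgeD(3) finite_subset by blast

section \<open>Counting vertex sets of size $k-1$\<close>

definition uncovered :: "'a set set" where
  "uncovered = {S. S \<subseteq> V \<and> card S = Suc j \<and> (\<forall>e\<in>E. \<not> S \<subseteq> e)}"

text \<open>By \<open>kernel_unique\<close>, the members of \<open>own e\<close> lie in no edge
  other than \<open>e\<close>.\<close>

definition own :: "'a set \<Rightarrow> 'a set set" where
  "own e = {S. S \<subseteq> e \<and> card S = Suc j} - {K e}"

lemma finite_uncovered: "finite uncovered"
  by (rule finite_subset[of _ "Pow V"]) (auto simp: uncovered_def finite_V)

lemma finite_own: "e \<in> E \<Longrightarrow> finite (own e)"
  by (rule finite_subset[of _ "Pow e"]) (auto simp: own_def edgeD(3))

lemma card_own: "e \<in> E \<Longrightarrow> card (own e) = Suc j"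
  using n_subsets[of e "Suc j"] edgeD(2,3) kernel_subset card_kernel
  by (simp add: own_def card_Diff_singleton)

lemma card_edges_le_choose:
  "Suc j * card E + card (K ` E) + card uncovered \<le> card V choose Suc j"
proof -
  have "card (\<Union>e\<in>E. own e) = (\<Sum>e\<in>E. card (own e))"
  proof (rule card_UN_disjoint)
    show "\<forall>e\<in>E. \<forall>f\<in>E. e \<noteq> f \<longrightarrow> own e \<inter> own f = {}"
      using kernel_unique by (auto simp: own_def)
  qed (auto simp: finite_E finite_own)
  then have UN: "card (\<Union>e\<in>E. own e) = Suc j * card E"
    by (simp add: card_own)
  \<comment> \<open>If \<open>K f\<close> were in \<open>own e\<close>, it would lie in both edges,
    forcing \<open>f = e\<close>, but \<open>own e\<close> omits \<open>K e\<close>.\<close>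
  have disj1: "(\<Union>e\<in>E. own e) \<inter> K ` E = {}"
    unfolding own_def using kernel_unique kernel_subset by blast
  have disj2: "((\<Union>e\<in>E. own e) \<union> K ` E) \<inter> uncovered = {}"
    unfolding own_def uncovered_def using kernel_subset by blast
  have fin: "finite (\<Union>e\<in>E. own e)" using finite_E finite_own by auto
  have "Suc j * card E + card (K ` E) + card uncovered
      = card ((\<Union>e\<in>E. own e) \<union> K ` E \<union> uncovered)"
    using UN disj1 disj2 fin finite_E finite_uncovered by (simp add: card_Un_disjoint)
  also have "\<dots> \<le> card {S. S \<subseteq> V \<and> card S = Suc j}"
  proof (rule card_mono)
    show "finite {S. S \<subseteq> V \<and> card S = Suc j}" using finite_V by simp
    show "(\<Union>e\<in>E. own e) \<union> K ` E \<union> uncovered \<subseteq> {S. S \<subseteq> V \<and> card S = Suc j}"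
      using edgeD(1) kernel_subset card_kernel by (fastforce simp: own_def uncovered_def)
  qed
  also have "\<dots> = card V choose Suc j" by (rule n_subsets[OF finite_V])
  finally show ?thesis .
qed

text \<open>An edge is determined by its kernel and its one remaining vertex, which is chosen
  outside the kernel.\<close>

lemma card_edges_le_kernels: "card E \<le> card (K ` E) * (card V - Suc j)"
proof -
  have "E \<subseteq> (\<Union>S\<in>K ` E. (\<lambda>x. insert x S) ` (V - S))"
  proof
    fix e assume e: "e \<in> E"
    obtain x where "x \<notin> K e" "e = insert x (K e)"
      using insert_eq_if_card_Suc[of e "K e"] edgeD e kernel_subset card_kernel by auto
    then show "e \<in> (\<Union>S\<in>K ` E. (\<lambda>x. insert x S) ` (V - S))"
      using e edgeD(1)[OF e] by blast
  qed
  then have "card E \<le> card (\<Union>S\<in>K ` E. (\<lambda>x. insert x S) ` (V - S))"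
    using finite_E finite_V by (intro card_mono) auto
  also have "\<dots> \<le> (\<Sum>S\<in>K ` E. card ((\<lambda>x. insert x S) ` (V - S)))"
    using finite_E by (intro card_UN_le) auto
  also have "\<dots> \<le> (\<Sum>S\<in>K ` E. card V - Suc j)"
  proof (rule sum_mono)
    fix S assume "S \<in> K ` E"
    then obtain e where e: "e \<in> E" "S = K e" by blast
    have "card ((\<lambda>x. insert x S) ` (V - S)) \<le> card (V - S)"
      using finite_V by (intro card_image_le) auto
    also have "\<dots> = card V - Suc j"
      using e kernel_subset[of e] edgeD(1)[of e] card_kernel finite_kernel
      by (auto simp: card_Diff_subset)
    finally show "card ((\<lambda>x. insert x S) ` (V - S)) \<le> card V - Suc j" .
  qed
  finally show ?thesis by simp
qed

section \<open>Counting vertex sets of size $k-2$\<close>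

definition inner :: "'a set set" where
  "inner = {T. T \<subseteq> V \<and> card T = j \<and> (\<exists>S\<in>K ` E \<union> uncovered. T \<subseteq> S)}"

definition outer :: "'a set set" where
  "outer = {T. T \<subseteq> V \<and> card T = j} - inner"

lemma finite_outer: "finite outer"
  using finite_V by (simp add: outer_def)

lemma card_inner: "card inner \<le> Suc j * (card (K ` E) + card uncovered)"
proof -
  have M: "finite S \<and> card S = Suc j" if "S \<in> K ` E \<union> uncovered" for S
    using that card_kernel finite_kernel finite_V
    by (auto simp: uncovered_def intro: finite_subset)
  have "inner \<subseteq> (\<Union>S\<in>K ` E \<union> uncovered. {T. T \<subseteq> S \<and> card T = j})"
    by (auto simp: inner_def)
  then have "card inner \<le> card (\<Union>S\<in>K ` E \<union> uncovered. {T. T \<subseteq> S \<and> card T = j})"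
    using finite_E finite_uncovered M by (intro card_mono) auto
  also have "\<dots> \<le> (\<Sum>S\<in>K ` E \<union> uncovered. card {T. T \<subseteq> S \<and> card T = j})"
    using finite_E finite_uncovered by (intro card_UN_le) auto
  also have "\<dots> = (\<Sum>S\<in>K ` E \<union> uncovered. Suc j)"
  proof (rule sum.cong[OF refl])
    fix S assume "S \<in> K ` E \<union> uncovered"
    then show "card {T. T \<subseteq> S \<and> card T = j} = Suc j"
      using M[of S] n_subsets[of S j] by simp
  qed
  also have "\<dots> \<le> Suc j * (card (K ` E) + card uncovered)"
    using mult_le_mono2[OF card_Un_le[of "K ` E" uncovered], of "Suc j"]
    by (simp only: sum_constant of_nat_id mult.commute)
  finally show ?thesis .
qed

text \<open>Of the $(j+2)(j+1)/2$ subsets of \<open>e\<close> of size \<open>j\<close>, exactly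
  $j+1$ lie in the kernel. Doubling avoids the division.\<close>

lemma card_subsets_outside_kernel:
  assumes "e \<in> E"
  shows "2 * card {T. T \<subseteq> e \<and> card T = j \<and> \<not> T \<subseteq> K e} = j * Suc j"
proof -
  let ?A = "{T. T \<subseteq> e \<and> card T = j}" and ?B = "{T. T \<subseteq> K e \<and> card T = j}"
  have eq: "{T. T \<subseteq> e \<and> card T = j \<and> \<not> T \<subseteq> K e} = ?A - ?B" by auto
  have "card ?B = Suc j"
    using n_subsets[OF finite_kernel[OF assms], of j] card_kernel[OF assms] by simp
  moreover have "2 * card ?A = (j + 2) * (j + 1)"
    using n_subsets[OF edgeD(3)[OF assms], of j] edgeD(2)[OF assms] Suc_Suc_choose_double by simp
  moreover have "card (?A - ?B) = card ?A - card ?B"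
    using finite_kernel[OF assms] kernel_subset[OF assms] by (intro card_Diff_subset) auto
  ultimately show ?thesis unfolding eq by (simp add: algebra_simps)
qed

lemma outer_degree:
  assumes T: "T \<in> outer"
  shows "card V - j \<le> 2 * card {e \<in> E. T \<subseteq> e \<and> \<not> T \<subseteq> K e}"
proof -
  let ?F = "{e \<in> E. T \<subseteq> e \<and> \<not> T \<subseteq> K e}"
  have T': "T \<subseteq> V" "card T = j" "finite T"
    using T finite_V by (auto simp: outer_def intro: finite_subset)
  have "V - T \<subseteq> (\<Union>e\<in>?F. e - T)"
  proof
    fix y assume y: "y \<in> V - T"
    \<comment> \<open>No superset of an outer \<open>T\<close> is uncovered, so some edge contains
      both \<open>T\<close> and \<open>y\<close>.\<close>
    have "insert y T \<notin> uncovered" using T by (auto simp: outer_def inner_def)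
    then obtain e where e: "e \<in> E" "insert y T \<subseteq> e"
      using T' y by (auto simp: uncovered_def)
    moreover have "\<not> T \<subseteq> K e" using T e by (auto simp: outer_def inner_def)
    ultimately show "y \<in> (\<Union>e\<in>?F. e - T)" using y by auto
  qed
  moreover have "finite (\<Union>e\<in>?F. e - T)"
    using finite_E edgeD(3) by (intro finite_UN_I) auto
  ultimately have "card (V - T) \<le> card (\<Union>e\<in>?F. e - T)"
    by (intro card_mono)
  also have "\<dots> \<le> (\<Sum>e\<in>?F. card (e - T))"
    using finite_E by (intro card_UN_le) auto
  \<comment> \<open>An edge has $j+2$ vertices and \<open>T\<close> has $j$.\<close>
  also have "\<dots> = (\<Sum>e\<in>?F. 2)"
    using T' edgeD(2) by (intro sum.cong) (auto simp: card_Diff_subset)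
  finally show ?thesis using T' by (simp add: card_Diff_subset)
qed

text \<open>Pairs of an outer \<open>T\<close> and an edge containing it, with \<open>T\<close>
  outside the kernel, are counted from both sides: \<open>outer_degree\<close> bounds them below,
  \<open>card_subsets_outside_kernel\<close> above.\<close>

lemma card_outer: "card outer \<le> j * Suc j * card (K ` E)"
proof -
  have "card outer * (card V - j) \<le> (\<Sum>T\<in>outer. 2 * card {e \<in> E. T \<subseteq> e \<and> \<not> T \<subseteq> K e})"
    using sum_mono[of outer "\<lambda>_. card V - j"] outer_degree by simp
  also have "\<dots> = 2 * (\<Sum>T\<in>outer. card {e \<in> E. T \<subseteq> e \<and> \<not> T \<subseteq> K e})"
    by (simp add: sum_distrib_left)
  also have "(\<Sum>T\<in>outer. card {e \<in> E. T \<subseteq> e \<and> \<not> T \<subseteq> K e})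
      = (\<Sum>e\<in>E. card {T \<in> outer. T \<subseteq> e \<and> \<not> T \<subseteq> K e})"
    by (rule sum_multicount_gen[OF finite_outer finite_E]) simp
  also have "\<dots> \<le> (\<Sum>e\<in>E. card {T. T \<subseteq> e \<and> card T = j \<and> \<not> T \<subseteq> K e})"
    using edgeD(3) by (intro sum_mono card_mono) (auto simp: outer_def)
  also have "2 * \<dots> = (\<Sum>e\<in>E. j * Suc j)"
    unfolding sum_distrib_left by (rule sum.cong[OF refl card_subsets_outside_kernel])
  also have "\<dots> = card E * (j * Suc j)" by simp
  also have "\<dots> \<le> (card (K ` E) * (card V - Suc j)) * (j * Suc j)"
    by (intro mult_right_mono card_edges_le_kernels) simp
  \<comment> \<open>Weakening the factor to \<open>card V - j\<close> matches the left side. It is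
    positive by \<open>card_V\<close> and so cancels.\<close>
  also have "\<dots> \<le> (card (K ` E) * (card V - j)) * (j * Suc j)"
    by (intro mult_right_mono mult_left_mono) auto
  finally have "card outer * (card V - j) \<le> (j * Suc j * card (K ` E)) * (card V - j)"
    by (simp only: ac_simps)
  then show ?thesis using card_V by (simp only: mult_le_cancel2)
qed

lemma choose_le_kernels_uncovered:
  "card V choose j \<le> (Suc j)\<^sup>2 * (card (K ` E) + card uncovered)"
proof -
  have "card V choose j = card {T. T \<subseteq> V \<and> card T = j}"
    by (rule n_subsets[OF finite_V, symmetric])
  also have "{T. T \<subseteq> V \<and> card T = j} = inner \<union> outer"
    by (auto simp: inner_def outer_def)
  also have "card (inner \<union> outer) \<le> card inner + card outer" by (rule card_Un_le)
  also have "\<dots> \<le> Suc j * (card (K ` E) + card uncovered) + j * Suc j * card (K ` E)"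
    by (intro add_mono card_inner card_outer)
  \<comment> \<open>The kernel terms agree exactly, as $(j+1) + j(j+1) = (j+1)^2$; only the
    uncovered term is enlarged.\<close>
  also have "\<dots> \<le> (Suc j)\<^sup>2 * (card (K ` E) + card uncovered)"
    by (simp add: power2_eq_square algebra_simps)
  finally show ?thesis .
qed

text \<open>This is the final bound cleared of denominators and subtraction:
  \<open>card_edges_le_choose\<close> is scaled by $(j+1)^2$ and its last two terms are replaced
  using \<open>choose_le_kernels_uncovered\<close>.\<close>

lemma card_edges_choose:
  "Suc j ^ 3 * card E + (card V choose j) \<le> (Suc j)\<^sup>2 * (card V choose Suc j)"
proof -
  have "Suc j ^ 3 * card E + (card V choose j)
      \<le> (Suc j)\<^sup>2 * (Suc j * card E + card (K ` E) + card uncovered)"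
    using choose_le_kernels_uncovered
    by (simp only: power3_eq_cube power2_eq_square distrib_left mult.assoc add.assoc)
  also have "\<dots> \<le> (Suc j)\<^sup>2 * (card V choose Suc j)"
    by (intro mult_left_mono card_edges_le_choose) simp
  finally show ?thesis .
qed

end

theorem theorem6:
  fixes V :: "'a set" and E :: "'a set set" and k n :: nat
  assumes "k \<ge> 2"
    and "two_hypertree k V E"
    and "n = card V"
    and "n \<ge> k"
  shows "real (card E) \<le> 1 / (real k - 1) * real (n choose (k - 1))
           - 1 / (real k - 1) ^ 3 * real (n choose (k - 2))"
proof -
  obtain j where k: "k = Suc (Suc j)"
    using assms(1) by (metis Suc_le_D numeral_2_eq_2 Suc_le_mono)
  note tree = assms(2)[unfolded k]
  have "\<forall>e\<in>E. \<exists>K\<subseteq>e. card K = Suc j \<and>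
    (\<forall>S f. S \<subseteq> e \<and> card S = Suc j \<and> S \<noteq> K \<and> f \<in> E \<and> S \<subseteq> f \<longrightarrow> f = e)"
    using two_hypertree_kernel[OF tree] by blast
  \<comment> \<open>One kernel is chosen for each edge, which supplies the function for the
    locale.\<close>
  then obtain K where K: "\<forall>e\<in>E. K e \<subseteq> e \<and> card (K e) = Suc j \<and>
    (\<forall>S f. S \<subseteq> e \<and> card S = Suc j \<and> S \<noteq> K e \<and> f \<in> E \<and> S \<subseteq> f \<longrightarrow> f = e)"
    by metis
  interpret kernel_hypergraph V E j K
  proof
    show "uniform_hypergraph (Suc (Suc j)) V E"
      using tree by (simp add: two_hypertree_def hypertree_def)
    show "Suc (Suc j) \<le> card V" using assms k by simp
  qed (use K in blast)+
  define m where "m = real (Suc j)"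
  have m: "m > 0" "real k - 1 = m" by (simp_all add: m_def k)
  have "real (Suc j ^ 3 * card E + (n choose j)) \<le> real ((Suc j)\<^sup>2 * (n choose Suc j))"
    unfolding of_nat_le_iff assms(3) by (rule card_edges_choose)
  then have "m ^ 3 * real (card E) \<le> m\<^sup>2 * real (n choose Suc j) - real (n choose j)"
    unfolding of_nat_add of_nat_mult of_nat_power m_def by linarith
  also have "\<dots> = m ^ 3 * (1 / m * real (n choose Suc j) - 1 / m ^ 3 * real (n choose j))"
    using m by (simp add: field_simps power2_eq_square power3_eq_cube)
  finally have "real (card E) \<le> 1 / m * real (n choose Suc j) - 1 / m ^ 3 * real (n choose j)"
    using m(1) by simp
  then show ?thesis unfolding m(2) by (simp add: k)
qed

end
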